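(* Let $d$ be a positive integer and let $F$ be a forest. Then the class of intersection graphs of axis-aligned boxes in $\mathbb{R}^d$ that contain no induced subgraph isomorphic to $F$ is polynomially $\chi$-bounded. That is, there exists a polynomial $f$ (depending only on $d$ and $F$) such that $\chi(G)\le f(\omega(G))$ for every graph $G$ which is the intersection graph of a collection of axis-aligned boxes in $\mathbb{R}^d$ and has no induced subgraph isomorphic to $F$.
   Context: All graphs (and collections of boxes) are finite. $\omega(G)$ and $\chi(G)$ denote the clique number and the chromatic number of a graph $G$. A class $\mathcal{G}$ of graphs is polynomially $\chi$-bounded if there is a polynomial function $f:\mathbb{N}\to\mathbb{N}$ with $\chi(G)\le f(\omega(G))$ for every $G\in\mathcal{G}$. An axis-aligned box in $\mathbb{R}^d$ is a product $[a_1,b_1]\times\cdots\times[a_d,b_d]$ of closed intervals with $a_i<b_i$. The intersection graph of a collection $\mathcal{B}$ of axis-aligned boxes is the graph with vertex set $\mathcal{B}$ in which two distinct members $B_1,B_2$ are adjacent if and only if $B_1\cap B_2\neq\emptyset$. *)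

theory Defs
  imports
    "HOL-Analysis.Analysis"
    "HOL-Computational_Algebra.Polynomial"
    "Graph_Theory.Digraph_Isomorphism"
begin

text \<open>
  A finite simple graph is a \<^locale>\<open>pair_graph\<close>: a finite vertex set with a symmetric and
  irreflexive set of ordered pairs, so every edge \<open>uv\<close> is present as \<open>(u, v)\<close> and \<open>(v, u)\<close>.
\<close>

text \<open>
  In this representation an edge traversed back and forth is a closed walk of length 2 that
  \<^const>\<open>pre_digraph.cycle\<close> accepts, so the library's \<^const>\<open>forest\<close> excludes every graph with
  an edge. The cycles of a simple graph are those of length at least 3.
\<close>

definition undirected_forest :: "'v pair_pre_digraph \<Rightarrow> bool" where
  "undirected_forest F \<longleftrightarrow>
     pair_graph F \<and> \<not> (\<exists>p. pre_digraph.cycle (with_proj F) p \<and> 3 \<le> length p)"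

definition contains_induced :: "'v pair_pre_digraph \<Rightarrow> 'w pair_pre_digraph \<Rightarrow> bool" where
  "contains_induced G F \<longleftrightarrow>
     (\<exists>H :: 'v pair_pre_digraph.
        induced_subgraph (with_proj H) (with_proj G) \<and> digraph_iso (with_proj F) (with_proj H))"

definition clique :: "'v pair_pre_digraph \<Rightarrow> 'v set \<Rightarrow> bool" where
  "clique G S \<longleftrightarrow> S \<subseteq> pverts G \<and> (\<forall>u\<in>S. \<forall>v\<in>S. u \<noteq> v \<longrightarrow> (u, v) \<in> parcs G)"

definition clique_number :: "'v pair_pre_digraph \<Rightarrow> nat" where
  "clique_number G = Max (card ` {S. clique G S})"

definition proper_coloring :: "'v pair_pre_digraph \<Rightarrow> nat \<Rightarrow> ('v \<Rightarrow> nat) \<Rightarrow> bool" where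
  "proper_coloring G k c \<longleftrightarrow>
     c ` pverts G \<subseteq> {..<k} \<and> (\<forall>(u, v)\<in>parcs G. c u \<noteq> c v)"

definition chromatic_number :: "'v pair_pre_digraph \<Rightarrow> nat" where
  "chromatic_number G = (LEAST k. \<exists>c. proper_coloring G k c)"

definition polynomial_function :: "(nat \<Rightarrow> nat) \<Rightarrow> bool" where
  "polynomial_function f \<longleftrightarrow> (\<exists>p :: real poly. \<forall>n. real (f n) = poly p (real n))"

definition polynomially_chi_bounded :: "'v pair_pre_digraph set \<Rightarrow> bool" where
  "polynomially_chi_bounded \<G> \<longleftrightarrow>
     (\<exists>f. polynomial_function f \<and> (\<forall>G\<in>\<G>. chromatic_number G \<le> f (clique_number G)))"

definition axis_aligned_box :: "(real ^ 'd) set \<Rightarrow> bool" where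
  "axis_aligned_box B \<longleftrightarrow> (\<exists>a b. (\<forall>i. a $ i < b $ i) \<and> B = cbox a b)"

definition intersection_graph :: "'a set set \<Rightarrow> 'a set pair_pre_digraph" where
  "intersection_graph \<B> =
     \<lparr>pverts = \<B>, parcs = {(A, B). A \<in> \<B> \<and> B \<in> \<B> \<and> A \<noteq> B \<and> A \<inter> B \<noteq> {}}\<rparr>"

definition box_intersection_graph :: "(real ^ 'd) set pair_pre_digraph \<Rightarrow> bool" where
  "box_intersection_graph G \<longleftrightarrow>
     (\<exists>\<B>. finite \<B> \<and> (\<forall>B\<in>\<B>. axis_aligned_box B) \<and> G = intersection_graph \<B>)"

lemma pair_graph_intersection_graph:
  assumes "finite \<B>"
  shows "pair_graph (intersection_graph \<B>)"
proof -
  have "finite (parcs (intersection_graph \<B>))"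
    by (rule finite_subset[of _ "\<B> \<times> \<B>"]) (auto simp: intersection_graph_def assms)
  then show ?thesis
    using assms
    by unfold_locales
      (auto simp: intersection_graph_def symmetric_def sym_def)
qed

lemma chromatic_number_attained:
  assumes "pair_graph G"
  shows "\<exists>c. proper_coloring G (chromatic_number G) c"
proof -
  interpret pair_graph G by (rule assms)
  obtain c :: "_ \<Rightarrow> nat" where c: "bij_betw c (pverts G) {0..<card (pverts G)}"
    using ex_bij_betw_finite_nat[OF pair_finite_verts] by blast
  have "proper_coloring G (card (pverts G)) c"
    unfolding proper_coloring_def
  proof (intro conjI ballI, goal_cases)
    case 1
    show ?case using c by (auto simp: bij_betw_def)
  next
    case (2 e)
    then obtain u v where e: "e = (u, v)" by (cases e)
    have "u \<noteq> v" "u \<in> pverts G" "v \<in> pverts G"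
      using 2 e pair_no_loops[of e] in_arcsD1 in_arcsD2 by auto
    then show ?case using c e by (auto simp: bij_betw_def dest: inj_onD)
  qed
  then show ?thesis
    unfolding chromatic_number_def by (rule LeastI[where P = "\<lambda>k. \<exists>c. proper_coloring G k c", OF exI])
qed

lemma clique_number_attained:
  assumes "finite (pverts G)"
  shows "\<exists>S. clique G S \<and> card S = clique_number G"
    and "clique G S \<Longrightarrow> card S \<le> clique_number G"
proof -
  have fin: "finite (card ` {S. clique G S})"
    by (rule finite_imageI, rule finite_subset[of _ "Pow (pverts G)"])
      (auto simp: clique_def assms)
  have "clique G {}" by (simp add: clique_def)
  then have "clique_number G \<in> card ` {S. clique G S}"
    unfolding clique_number_def by (intro Max_in[OF fin]) auto
  then show "\<exists>S. clique G S \<and> card S = clique_number G" by auto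
  show "card S \<le> clique_number G" if "clique G S"
    unfolding clique_number_def using that by (intro Max_ge[OF fin]) auto
qed

lemma contains_induced_iff:
  assumes "pair_graph G" "pair_graph F"
  shows "contains_induced G F \<longleftrightarrow>
    (\<exists>\<phi>. inj_on \<phi> (pverts F) \<and> \<phi> ` pverts F \<subseteq> pverts G \<and>
      (\<forall>u\<in>pverts F. \<forall>v\<in>pverts F. (u, v) \<in> parcs F \<longleftrightarrow> (\<phi> u, \<phi> v) \<in> parcs G))"
    (is "_ \<longleftrightarrow> (\<exists>\<phi>. ?emb \<phi>)")
proof
  interpret F: pair_graph F by (rule assms)
  interpret G: pair_graph G by (rule assms)
  show "\<exists>\<phi>. ?emb \<phi>" if "contains_induced G F"
  proof -
    from that obtain H h where ind: "induced_subgraph (with_proj H) (with_proj G)"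
      and h: "pre_digraph.digraph_isomorphism (with_proj F) h"
      and H: "with_proj H = app_iso h (with_proj F)"
      unfolding contains_induced_def digraph_iso_def by blast
    define \<phi> where "\<phi> = iso_verts h"
    have inj: "inj_on \<phi> (pverts F)"
      using h by (simp add: F.digraph_isomorphism_def \<phi>_def)
    have vH: "pverts H = \<phi> ` pverts F"
      using arg_cong[OF H, of verts] by (simp add: \<phi>_def)
    have aH: "parcs H = iso_arcs h ` parcs F"
      using arg_cong[OF H, of arcs] by simp
    have "fst = iso_tail h" "snd = iso_head h"
      using arg_cong[OF H, of tail] arg_cong[OF H, of head] by simp_all
    then have ia: "iso_arcs h (u, v) = (\<phi> u, \<phi> v)" if "(u, v) \<in> parcs F" for u v
      using h that by (auto simp: F.digraph_isomorphism_def \<phi>_def prod_eq_iff)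
    have sub: "pverts H \<subseteq> pverts G"
      and arcs: "parcs H = {e \<in> parcs G. fst e \<in> pverts H \<and> snd e \<in> pverts H}"
      using ind by (auto simp: induced_subgraph_def subgraph_def)
    have "(u, v) \<in> parcs F \<longleftrightarrow> (\<phi> u, \<phi> v) \<in> parcs G" if uv: "u \<in> pverts F" "v \<in> pverts F" for u v
    proof
      assume "(u, v) \<in> parcs F"
      then have "(\<phi> u, \<phi> v) \<in> parcs H" using ia aH by (metis imageI)
      then show "(\<phi> u, \<phi> v) \<in> parcs G" using arcs by auto
    next
      assume "(\<phi> u, \<phi> v) \<in> parcs G"
      then have "(\<phi> u, \<phi> v) \<in> parcs H" using arcs vH uv by auto
      then obtain x y where xy: "(x, y) \<in> parcs F" "(\<phi> u, \<phi> v) = iso_arcs h (x, y)"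
        using aH by auto
      then have "\<phi> u = \<phi> x" "\<phi> v = \<phi> y" using ia by auto
      then have "u = x" "v = y"
        using inj uv F.in_arcsD1[OF xy(1)] F.in_arcsD2[OF xy(1)] by (auto dest: inj_onD)
      then show "(u, v) \<in> parcs F" using xy by simp
    qed
    then show ?thesis using inj sub vH by blast
  qed
  show "contains_induced G F" if "\<exists>\<phi>. ?emb \<phi>"
  proof -
    from that obtain \<phi> where \<phi>: "?emb \<phi>" by blast
    define H where "H = \<lparr>pverts = \<phi> ` pverts F, parcs = map_prod \<phi> \<phi> ` parcs F\<rparr>"
    define h :: "(_, _, _, _) digraph_isomorphism" where
      "h = \<lparr>iso_verts = \<phi>, iso_arcs = map_prod \<phi> \<phi>, iso_head = snd, iso_tail = fst\<rparr>"
    have arcs: "parcs H = {e \<in> parcs G. fst e \<in> pverts H \<and> snd e \<in> pverts H}"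
    proof (intro set_eqI iffI)
      fix e assume "e \<in> parcs H"
      then obtain u v where uv: "(u, v) \<in> parcs F" "e = (\<phi> u, \<phi> v)"
        by (auto simp: H_def)
      then show "e \<in> {e \<in> parcs G. fst e \<in> pverts H \<and> snd e \<in> pverts H}"
        using \<phi> F.in_arcsD1[OF uv(1)] F.in_arcsD2[OF uv(1)] by (simp add: H_def)
    next
      fix e assume e: "e \<in> {e \<in> parcs G. fst e \<in> pverts H \<and> snd e \<in> pverts H}"
      then obtain u v where uv: "u \<in> pverts F" "v \<in> pverts F" "e = (\<phi> u, \<phi> v)"
        by (cases e) (auto simp: H_def)
      then have "(u, v) \<in> parcs F" using e \<phi> by simp
      then show "e \<in> parcs H" using uv(3) by (force simp: H_def)
    qed
    have "wf_digraph (with_proj H)"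
      by unfold_locales (auto simp: H_def F.in_arcsD1 F.in_arcsD2)
    moreover have "pverts H \<subseteq> pverts G" using \<phi> by (simp add: H_def)
    ultimately have "induced_subgraph (with_proj H) (with_proj G)"
      using arcs G.wf_digraph
      by (auto simp: induced_subgraph_def subgraph_def compatible_def)
    moreover have "inj_on (map_prod \<phi> \<phi>) (parcs F)"
    proof (rule inj_on_subset[OF map_prod_inj_on])
      show "inj_on \<phi> (pverts F)" "inj_on \<phi> (pverts F)" using \<phi> by auto
      show "parcs F \<subseteq> pverts F \<times> pverts F" using F.in_arcsD1 F.in_arcsD2 by auto
    qed
    then have "pre_digraph.digraph_isomorphism (with_proj F) h"
      using \<phi> F.wf_digraph by (auto simp: F.digraph_isomorphism_def h_def)
    moreover have "with_proj H = app_iso h (with_proj F)"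
      by (simp add: app_iso_def h_def H_def with_proj_def)
    ultimately show ?thesis
      unfolding contains_induced_def digraph_iso_def by blast
  qed
qed

end

theory Submission
  imports Defs
begin

text \<open>
  Write a box as the list of its \<open>2 * d\<close> endpoints. Choosing for every endpoint coordinate whether
  it should increase or decrease (a sign pattern) turns the boxes into a partially ordered set, and
  any two distinct boxes are comparable for some pattern. So the edges of the intersection graph
  are covered by \<open>4 ^ d\<close> acyclic digraphs, one per pattern, and it suffices to colour each of them
  with polynomially many colours; the product of the colourings is a proper colouring of the graph.

  Two geometric facts hold for the digraph of a fixed pattern. If \<open>u\<close> and \<open>w\<close> are disjoint and
  \<open>u \<le> w \<le> x\<close>, then \<open>u\<close> and \<open>x\<close> are disjoint (\<open>meets_between\<close>). If \<open>w\<close> and \<open>w'\<close> are disjoint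
  out-neighbours of one box, then a coordinate that separates them is one in which boxes shrink along
  the pattern, so everything above \<open>w\<close> is disjoint from everything above \<open>w'\<close>
  (\<open>disjoint_descendants\<close>). Hence an out-tree is induced, even in the whole intersection graph, as
  soon as siblings are disjoint and no box meets its grandparent. This is where bicliques, which
  box graphs contain in abundance, stop being an obstacle.

  Call an edge \<open>u \<rightarrow> v\<close> good if \<open>v\<close> has many out-neighbours that are not out-neighbours of \<open>u\<close>, and
  iterate: at level \<open>k + 1\<close> the edges to these out-neighbours must be in level \<open>k\<close>. An edge in level
  \<open>k\<close> yields an induced tree of depth \<open>k\<close> and large branching, as many boxes without a large clique
  include many pairwise disjoint ones (\<open>ex_induced_tree\<close>). Every forest embeds into such a tree, so
  in a graph without the forest some level is empty for every pattern.

  It remains to colour the edges that drop out between two levels (\<open>colourable_diff_level\<close>). If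
  \<open>u \<rightarrow> v\<close> drops out, then \<open>v\<close> has few out-neighbours that \<open>u\<close> does not have; by the geometry, for
  fixed \<open>v\<close> and varying \<open>u\<close> all of these lie in one small set, since each lies at an extreme end of
  the out-neighbourhood in one of the \<open>2 * d\<close> directions (\<open>card_near_le\<close>). The edges to these sets
  form an acyclic digraph of small out-degree and are coloured greedily. Inside a colour class a
  dropped edge \<open>u \<rightarrow> v\<close> satisfies that every out-neighbour of \<open>v\<close> is one of \<open>u\<close>; such edges form a
  transitive relation, whose chains are cliques, so the clique number many colours suffice.
\<close>

section \<open>Proper colourings of relations\<close>

text \<open>
  Colourings are total functions, so that they can be multiplied without tracking vertex sets;
  hence \<open>n\<close> is positive even if \<open>R\<close> is empty.
\<close>

definition colourable :: "'a rel \<Rightarrow> nat \<Rightarrow> bool" where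
  "colourable R n \<longleftrightarrow> (\<exists>f. (\<forall>v. f v < n) \<and> (\<forall>(u, v)\<in>R. f u \<noteq> f v))"

lemma colourableI:
  assumes "\<And>v. f v < n" "\<And>u v. (u, v) \<in> R \<Longrightarrow> f u \<noteq> f v"
  shows "colourable R n"
  using assms unfolding colourable_def by blast

lemma colourableE:
  assumes "colourable R n"
  obtains f where "\<And>v. f v < n" "\<And>u v. (u, v) \<in> R \<Longrightarrow> f u \<noteq> f v"
  using assms unfolding colourable_def by blast

lemma colourable_mono: "colourable R n \<Longrightarrow> S \<subseteq> R \<Longrightarrow> colourable S n"
  unfolding colourable_def by blast

lemma colourable_Un:
  assumes "colourable R m" "colourable S n"
  shows "colourable (R \<union> S) (m * n)"
proof -
  obtain f where f: "\<And>v. f v < m" "\<And>u v. (u, v) \<in> R \<Longrightarrow> f u \<noteq> f v"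
    using assms(1) by (rule colourableE) blast
  obtain g where g: "\<And>v. g v < n" "\<And>u v. (u, v) \<in> S \<Longrightarrow> g u \<noteq> g v"
    using assms(2) by (rule colourableE) blast
  show ?thesis
  proof (rule colourableI[where f = "\<lambda>v. f v * n + g v"])
    fix v
    have "f v * n + g v < (f v + 1) * n" using g(1)[of v] by simp
    also have "\<dots> \<le> m * n" using f(1)[of v] by (intro mult_le_mono1) simp
    finally show "f v * n + g v < m * n" .
  next
    have dm: "(f v * n + g v) div n = f v" "(f v * n + g v) mod n = g v" for v
      using g(1)[of v] by simp_all
    show "f u * n + g u \<noteq> f v * n + g v" if "(u, v) \<in> R \<union> S" for u v
      using that f(2) g(2) dm[of u] dm[of v] by (metis UnE)
  qed
qed

lemma colourable_UN:
  assumes "finite I" "\<And>i. i \<in> I \<Longrightarrow> colourable (R i) n"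
  shows "colourable (\<Union>i\<in>I. R i) (n ^ card I)"
  using assms
proof (induction I rule: finite_induct)
  case empty
  show ?case by (rule colourableI[where f = "\<lambda>_. 0"]) auto
next
  case (insert i I)
  then have "colourable (R i \<union> (\<Union>i\<in>I. R i)) (n * n ^ card I)"
    by (intro colourable_Un) auto
  then show ?case using insert by simp
qed

text \<open>
  Greedy colouring: as \<open>R\<close> is finite and acyclic, the out-neighbours of a vertex can be coloured
  before the vertex, which then takes the least colour not used on them.
\<close>
lemma colourable_if_out_degree_le:
  assumes "finite R" "acyclic R" and deg: "\<And>v. card (R `` {v}) \<le> m"
  shows "colourable R (m + 1)"
proof -
  have wf: "wf (R\<inverse>)" using assms(1,2) by (rule finite_acyclic_wf_converse)
  define f :: "'a \<Rightarrow> nat" where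
    "f = wfrec (R\<inverse>) (\<lambda>f v. LEAST c. c \<notin> f ` (R `` {v}))"
  have f: "f v = (LEAST c. c \<notin> f ` (R `` {v}))" for v
  proof -
    have "cut f (R\<inverse>) v ` (R `` {v}) = f ` (R `` {v})"
      by (intro image_cong) (auto simp: cut_def)
    then show ?thesis using def_wfrec[OF f_def[THEN eq_reflection] wf, of v] by simp
  qed
  have free: "\<exists>c\<le>m. c \<notin> f ` (R `` {v})" for v
  proof (rule ccontr)
    assume "\<not> ?thesis"
    then have "{..m} \<subseteq> f ` (R `` {v})" by auto
    moreover have fin: "finite (R `` {v})" using assms(1) by (rule finite_Image)
    ultimately have "card {..m} \<le> card (R `` {v})"
      by (meson card_image_le card_mono finite_imageI le_trans)
    then show False using deg[of v] by simp
  qed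
  show ?thesis
  proof (rule colourableI[where f = f])
    show "f v < m + 1" for v
    proof -
      obtain c where "c \<le> m" "c \<notin> f ` (R `` {v})" using free by blast
      then show ?thesis using Least_le[of "\<lambda>c. c \<notin> f ` (R `` {v})" c] f[of v] by simp
    qed
    show "f u \<noteq> f v" if "(u, v) \<in> R" for u v
    proof -
      have "f u \<notin> f ` (R `` {u})"
        using f[of u] LeastI_ex[of "\<lambda>c. c \<notin> f ` (R `` {u})"] free[of u] by auto
      then show ?thesis using that by auto
    qed
  qed
qed

definition is_chain :: "'a rel \<Rightarrow> 'a set \<Rightarrow> bool" where
  "is_chain R S \<longleftrightarrow> (\<forall>x\<in>S. \<forall>y\<in>S. x \<noteq> y \<longrightarrow> (x, y) \<in> R \<or> (y, x) \<in> R)"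

lemma is_chainD: "is_chain R S \<Longrightarrow> x \<in> S \<Longrightarrow> y \<in> S \<Longrightarrow> x \<noteq> y \<Longrightarrow> (x, y) \<in> R \<or> (y, x) \<in> R"
  unfolding is_chain_def by simp

text \<open>
  Mirsky's theorem: the colour of \<open>v\<close> is the size of the largest
  chain strictly above it, which drops along every pair of \<open>R\<close>.
\<close>
lemma colourable_if_chains_le:
  assumes "finite R" "trans R" "irrefl R"
    and chain: "\<And>S. finite S \<Longrightarrow> is_chain R S \<Longrightarrow> card S \<le> n"
  shows "colourable R n"
proof -
  define C where "C v = {S. S \<subseteq> R `` {v} \<and> is_chain R S}" for v
  define f where "f v = Max (card ` C v)" for v
  have fin_im: "finite (R `` {v})" for v using assms(1) by (rule finite_Image)
  have fin: "finite (card ` C v)" for v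
    by (rule finite_imageI, rule finite_subset[of _ "Pow (R `` {v})"]) (auto simp: C_def fin_im)
  have "{} \<in> C v" for v by (simp add: C_def is_chain_def)
  then have "f v \<in> card ` C v" for v
    unfolding f_def by (intro Max_in[OF fin]) auto
  then have "\<exists>S. f v = card S \<and> S \<in> C v" for v by blast
  then obtain S where S: "\<And>v. f v = card (S v)" "\<And>v. S v \<in> C v" by metis
  have finS: "finite (S v)" for v
    using S(2)[of v] fin_im[of v] unfolding C_def by (blast intro: finite_subset)
  have notin: "v \<notin> S v" for v
    using S(2)[of v] assms(3) unfolding C_def irrefl_def by blast
  have ins: "is_chain R (insert v (S v))" for v
    using S(2)[of v] unfolding C_def is_chain_def by auto
  show ?thesis
  proof (rule colourableI[where f = f])
    show "f v < n" for v
      using chain[OF _ ins[of v]] finS[of v] notin[of v] S(1)[of v] by simp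
    show "f u \<noteq> f v" if "(u, v) \<in> R" for u v
    proof -
      have "S v \<subseteq> R `` {u}" using S(2)[of v] that assms(2) unfolding C_def by (blast dest: transD)
      then have "insert v (S v) \<in> C u" using that ins[of v] unfolding C_def by blast
      then have "card (insert v (S v)) \<le> f u" unfolding f_def by (intro Max_ge[OF fin]) auto
      then show ?thesis using finS[of v] notin[of v] S(1)[of v] by simp
    qed
  qed
qed

section \<open>Levels of a digraph\<close>

text \<open>
  An edge \<open>(u, v)\<close> in level \<open>k\<close> can be continued beyond \<open>v\<close> by a tree of depth \<open>k\<close> in which every
  inner vertex has at least \<open>M\<close> children, none of them an out-neighbour of its grandparent.
\<close>

fun level :: "'a rel \<Rightarrow> nat \<Rightarrow> nat \<Rightarrow> 'a rel" where
  "level E M 0 = E"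
| "level E M (Suc k) = {(u, v). (u, v) \<in> E \<and> M \<le> card {w. (v, w) \<in> level E M k \<and> (u, w) \<notin> E}}"

lemma level_subset: "level E M k \<subseteq> E"
  by (cases k) auto

text \<open>
  All out-neighbours of \<open>v\<close> that can prevent an edge \<open>(u, v)\<close> outside the next level from being
  transitive, gathered over all such \<open>u\<close>.
\<close>
definition near :: "'a rel \<Rightarrow> nat \<Rightarrow> 'a rel \<Rightarrow> 'a \<Rightarrow> 'a set" where
  "near E M A v = \<Union> {W. card W < M \<and> (\<exists>u. (u, v) \<in> E \<and> W = {w. (v, w) \<in> A \<and> (u, w) \<notin> E})}"

lemma near_subset: "near E M A v \<subseteq> A `` {v}"
  unfolding near_def by blast

text \<open>
  The edges outside level \<open>k + 1\<close> are coloured by three successive refinements: a colouring of the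
  edges outside level \<open>k\<close>, a greedy colouring of the edges from each \<open>v\<close> to its near set, and a chain
  colouring. After the first two, every edge \<open>(v, w)\<close> inside a colour class is in level \<open>k\<close> and not
  near; so if \<open>(u, v)\<close> is outside level \<open>k + 1\<close>, then \<open>(u, w)\<close> is an edge again.
\<close>
lemma colourable_diff_level:
  assumes fin: "finite E" and ac: "acyclic E"
    and near: "\<And>A v. A \<subseteq> E \<Longrightarrow> card (near E M A v) \<le> m"
    and clq: "\<And>S. finite S \<Longrightarrow> is_chain E S \<Longrightarrow> card S \<le> n"
  shows "colourable (E - level E M k) (((m + 1) * n) ^ k)"
proof (induction k)
  case 0
  show ?case by (rule colourableI[where f = "\<lambda>_. 0"]) auto
next
  case (Suc k)
  define A where "A = level E M k"
  define N where "N = {(v, w). w \<in> near E M A v}"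
  have AE: "A \<subseteq> E" unfolding A_def by (rule level_subset)
  have NE: "N \<subseteq> E" using near_subset[of E M A] AE unfolding N_def by blast
  have "colourable N (m + 1)"
  proof (rule colourable_if_out_degree_le)
    show "finite N" using NE fin by (rule finite_subset)
    show "acyclic N" using ac NE by (rule acyclic_subset)
    show "card (N `` {v}) \<le> m" for v
      using near[OF AE, of v] by (simp add: N_def Image_def)
  qed
  with Suc have "colourable ((E - A) \<union> N) (((m + 1) * n) ^ k * (m + 1))"
    unfolding A_def by (intro colourable_Un)
  then obtain c where c: "\<And>v. c v < ((m + 1) * n) ^ k * (m + 1)"
      "\<And>u v. (u, v) \<in> (E - A) \<union> N \<Longrightarrow> c u \<noteq> c v"
    by (rule colourableE) blast
  \<comment> \<open>Domination of out-neighbourhoods, rather than the complement of the level, makes \<open>R\<close> transitive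
    without any further argument.\<close>
  define R where "R = {(u, v). (u, v) \<in> E \<and> c u = c v \<and>
    (\<forall>w. c w = c v \<longrightarrow> (v, w) \<in> E \<longrightarrow> (u, w) \<in> E)}"
  have "colourable R n"
  proof (rule colourable_if_chains_le)
    show "finite R" using fin by (rule finite_subset[rotated]) (auto simp: R_def)
    show "trans R" unfolding trans_def R_def by auto
    show "irrefl R" using ac by (auto simp: irrefl_def R_def acyclic_def)
    show "card S \<le> n" if "finite S" "is_chain R S" for S
      using that by (intro clq) (auto simp: is_chain_def R_def)
  qed
  moreover have "colourable {(u, v). c u \<noteq> c v} (((m + 1) * n) ^ k * (m + 1))"
    using c(1) by (intro colourableI[where f = c]) auto
  ultimately have "colourable ({(u, v). c u \<noteq> c v} \<union> R) (((m + 1) * n) ^ k * (m + 1) * n)"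
    by (rule colourable_Un[rotated])
  then have "colourable ({(u, v). c u \<noteq> c v} \<union> R) (((m + 1) * n) ^ Suc k)"
    by (simp only: power_Suc ac_simps)
  moreover have "E - level E M (Suc k) \<subseteq> {(u, v). c u \<noteq> c v} \<union> R"
  proof clarify
    fix u v
    assume uv: "(u, v) \<in> E" "(u, v) \<notin> level E M (Suc k)" "(u, v) \<notin> R" "c u = c v"
    then have small: "card {w. (v, w) \<in> A \<and> (u, w) \<notin> E} < M" by (simp add: A_def)
    from uv obtain w where w: "c w = c v" "(v, w) \<in> E" "(u, w) \<notin> E" by (auto simp: R_def)
    then have "(v, w) \<in> A" using c(2)[of v w] by auto
    with w small uv(1) have "(v, w) \<in> N" unfolding N_def near_def by blast
    then show False using c(2)[of v w] w(1) by auto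
  qed
  ultimately show ?case by (rule colourable_mono)
qed

section \<open>Sign patterns on a family of boxes\<close>

text \<open>
  Superlevel sets are nested, so the union of the small ones is itself a small one.
\<close>
lemma card_Union_small_superlevel_le:
  fixes g :: "'a \<Rightarrow> real"
  assumes "finite X"
  shows "card (\<Union> {W. card W < M \<and> (\<exists>c. W = {w \<in> X. c < g w})}) \<le> M"
proof -
  define U where "U = \<Union> {W. card W < M \<and> (\<exists>c. W = {w \<in> X. c < g w})}"
  have fin: "finite U" using assms by (rule finite_subset[rotated]) (auto simp: U_def)
  have "card U \<le> M"
  proof (cases "U = {}")
    case False
    define w0 where "w0 = arg_min_on g U"
    have "w0 \<in> U" unfolding w0_def by (rule arg_min_if_finite(1)[OF fin False])
    then obtain c where c: "card {w \<in> X. c < g w} < M" "c < g w0" by (auto simp: U_def)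
    have "U \<subseteq> {w \<in> X. c < g w}"
    proof
      fix w assume w: "w \<in> U"
      then have "w \<in> X" by (auto simp: U_def)
      moreover have "g w0 \<le> g w" unfolding w0_def by (rule arg_min_least[OF fin False w])
      ultimately show "w \<in> {w \<in> X. c < g w}" using c(2) by simp
    qed
    then have "card U \<le> card {w \<in> X. c < g w}" using assms by (intro card_mono) auto
    then show ?thesis using c(1) by simp
  qed simp
  then show ?thesis by (simp only: U_def)
qed

text \<open>
  The vertices of the complete \<open>K\<close>-ary tree of depth \<open>k\<close>: the root is the empty list and the
  children of \<open>xs\<close> are the lists \<open>xs @ [a]\<close>.
\<close>
definition words :: "nat \<Rightarrow> nat \<Rightarrow> nat list set" where
  "words K k = {xs. set xs \<subseteq> {..<K} \<and> length xs \<le> k}"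

text \<open>
  Boxes are kept abstract and given by their endpoints in every coordinate \<open>i\<close>; only the order of
  the endpoints is relevant.
\<close>
locale box_family =
  fixes V :: "'a set" and lo hi :: "'i::finite \<Rightarrow> 'a \<Rightarrow> real"
  assumes finite_V: "finite V"
    and lo_le_hi: "v \<in> V \<Longrightarrow> lo i v \<le> hi i v"
    and box_eqI: "\<lbrakk>u \<in> V; v \<in> V; \<And>i. lo i u = lo i v; \<And>i. hi i u = hi i v\<rbrakk> \<Longrightarrow> u = v"
begin

definition meets :: "'a \<Rightarrow> 'a \<Rightarrow> bool" where
  "meets u v \<longleftrightarrow> (\<forall>i. lo i u \<le> hi i v \<and> lo i v \<le> hi i u)"

text \<open>
  The order of the sign pattern \<open>s\<close>: the two components of \<open>s i\<close> say whether the lower and the upper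
  endpoints in coordinate \<open>i\<close> increase. Along the order, boxes grow in coordinate \<open>i\<close> for
  \<open>(False, True)\<close>, shrink for \<open>(True, False)\<close>, and move right or left otherwise.
\<close>
definition below :: "('i \<Rightarrow> bool \<times> bool) \<Rightarrow> 'a \<Rightarrow> 'a \<Rightarrow> bool" where
  "below s u v \<longleftrightarrow> (\<forall>i.
     (if fst (s i) then lo i u \<le> lo i v else lo i v \<le> lo i u) \<and>
     (if snd (s i) then hi i u \<le> hi i v else hi i v \<le> hi i u))"

definition arcs :: "('i \<Rightarrow> bool \<times> bool) \<Rightarrow> 'a rel" where
  "arcs s = {(u, v). u \<in> V \<and> v \<in> V \<and> u \<noteq> v \<and> below s u v \<and> meets u v}"

lemma meets_sym: "meets u v \<longleftrightarrow> meets v u"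
  unfolding meets_def by auto

lemma meets_refl: "v \<in> V \<Longrightarrow> meets v v"
  unfolding meets_def by (simp add: lo_le_hi)

lemma below_refl: "below s v v"
  unfolding below_def by simp

lemma below_trans: "below s u v \<Longrightarrow> below s v w \<Longrightarrow> below s u w"
  unfolding below_def by (meson order_trans)

lemma below_antisym:
  assumes "u \<in> V" "v \<in> V" "below s u v" "below s v u"
  shows "u = v"
proof (rule box_eqI[OF assms(1,2)])
  show "lo i u = lo i v" "hi i u = hi i v" for i
    using assms(3)[unfolded below_def, rule_format, of i]
      assms(4)[unfolded below_def, rule_format, of i] by (auto split: if_splits)
qed

lemma finite_arcs: "finite (arcs s)"
  by (rule finite_subset[of _ "V \<times> V"]) (auto simp: arcs_def finite_V)

lemma acyclic_arcs: "acyclic (arcs s)"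
proof (rule acyclic_subset)
  let ?L = "{(u, v). u \<in> V \<and> v \<in> V \<and> u \<noteq> v \<and> below s u v}"
  have "trans ?L" unfolding trans_def
    by (auto dest: below_trans below_antisym)
  then show "acyclic ?L" unfolding acyclic_def by simp
  show "arcs s \<subseteq> ?L" unfolding arcs_def by auto
qed

lemma ex_arcs_if_meets:
  assumes "u \<in> V" "v \<in> V" "u \<noteq> v" "meets u v"
  shows "\<exists>s. (u, v) \<in> arcs s"
proof
  show "(u, v) \<in> arcs (\<lambda>i. (lo i u \<le> lo i v, hi i u \<le> hi i v))"
    using assms by (auto simp: arcs_def below_def)
qed

text \<open>
  In each coordinate, the endpoints of \<open>w\<close> lie between those of \<open>u\<close> and \<open>x\<close>, so whichever way an
  endpoint of \<open>w\<close> moves, it is caught by \<open>u\<close> itself or by \<open>x\<close>.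
\<close>
lemma meets_between:
  assumes "u \<in> V" "below s u w" "below s w x" "meets u x"
  shows "meets u w"
  unfolding meets_def
proof (intro allI)
  fix i
  show "lo i u \<le> hi i w \<and> lo i w \<le> hi i u"
    using assms(2)[unfolded below_def, rule_format, of i]
      assms(3)[unfolded below_def, rule_format, of i]
      assms(4)[unfolded meets_def, rule_format, of i] lo_le_hi[OF assms(1), of i]
    by (auto split: if_splits)
qed

text \<open>
  If boxes grow in a coordinate or move to one side in it, then all boxes that meet \<open>v\<close> and lie above
  it share an endpoint of \<open>v\<close> there. So a coordinate separating \<open>w\<close> from \<open>w'\<close> is one in which boxes
  shrink, and the separation is inherited by everything above them.
\<close>
lemma disjoint_descendants:
  assumes "(v, w) \<in> arcs s" "(v, w') \<in> arcs s" "\<not> meets w w'" "below s w x" "below s w' x'"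
  shows "\<not> meets x x'"
proof -
  have *: "\<exists>i. hi i x < lo i x'"
    if vw: "(v, w) \<in> arcs s" "(v, w') \<in> arcs s" "hi i w < lo i w'" "below s w x" "below s w' x'"
    for i w w' x x'
  proof -
    have v: "v \<in> V" "below s v w" "below s v w'" "meets v w" "meets v w'"
      using vw unfolding arcs_def by auto
    show ?thesis
      using v(2)[unfolded below_def, rule_format, of i]
      v(3)[unfolded below_def, rule_format, of i]
      v(4)[unfolded meets_def, rule_format, of i]
      v(5)[unfolded meets_def, rule_format, of i]
      vw(4)[unfolded below_def, rule_format, of i]
      vw(5)[unfolded below_def, rule_format, of i] vw(3)
      by (intro exI[of _ i]) (auto split: if_splits)
  qed
  from assms(3) obtain i where "hi i w < lo i w' \<or> hi i w' < lo i w"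
    unfolding meets_def by (auto simp: not_le)
  then have "(\<exists>i. hi i x < lo i x') \<or> (\<exists>i. hi i x' < lo i x)"
    using * assms by meson
  then show ?thesis unfolding meets_def by (auto simp: not_le)
qed

text \<open>
  If \<open>u \<le> v \<le> w\<close>, then \<open>w\<close> misses \<open>u\<close> only because some lower endpoint of \<open>w\<close> is too large or some
  upper endpoint is too small. So the out-neighbours of \<open>v\<close> missing \<open>u\<close> form a union of superlevel
  sets of \<open>2 * CARD('i)\<close> functions that do not depend on \<open>u\<close>; if the union is small, so is each set.
\<close>
lemma card_near_le:
  assumes "A \<subseteq> arcs s"
  shows "card (near (arcs s) M A v) \<le> 2 * CARD('i) * M"
proof -
  define X where "X = A `` {v}"
  define g where "g p w = (if snd p then lo (fst p) w else - hi (fst p) w)" for p :: "'i \<times> bool" and w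
  define U where "U p = \<Union> {W. card W < M \<and> (\<exists>c. W = {w \<in> X. c < g p w})}" for p
  have finX: "finite X" unfolding X_def using assms finite_arcs by (blast intro: finite_Image finite_subset)
  have "near (arcs s) M A v \<subseteq> (\<Union>p\<in>UNIV. U p)"
  proof
    fix w assume "w \<in> near (arcs s) M A v"
    then obtain u where u: "(u, v) \<in> arcs s" "card {w. (v, w) \<in> A \<and> (u, w) \<notin> arcs s} < M"
      and w: "(v, w) \<in> A" "(u, w) \<notin> arcs s"
      unfolding near_def by blast
    have arcs_iff: "(u, x) \<in> arcs s \<longleftrightarrow> meets u x" if "(v, x) \<in> A" for x
    proof -
      have "below s u v" "below s v x" "u \<in> V" "v \<in> V" "u \<noteq> v" "x \<in> V"
        using u(1) that assms unfolding arcs_def by auto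
      then show ?thesis unfolding arcs_def
        by (auto intro: below_trans dest: below_antisym)
    qed
    from w arcs_iff have "\<not> meets u w" by blast
    then obtain i where "hi i u < lo i w \<or> hi i w < lo i u"
      unfolding meets_def by (auto simp: not_le)
    then obtain p c where pc: "c < g p w" "\<And>x. c < g p x \<Longrightarrow> \<not> meets u x"
    proof
      assume "hi i u < lo i w"
      then show ?thesis
        by (intro that[of "hi i u" "(i, True)"]) (auto simp: g_def meets_def not_le intro!: exI[of _ i])
    next
      assume "hi i w < lo i u"
      then show ?thesis
        by (intro that[of "- lo i u" "(i, False)"]) (auto simp: g_def meets_def not_le intro!: exI[of _ i])
    qed
    have "{x \<in> X. c < g p x} \<subseteq> {w. (v, w) \<in> A \<and> (u, w) \<notin> arcs s}"
      using pc(2) arcs_iff unfolding X_def by blast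
    moreover have "finite {w. (v, w) \<in> A \<and> (u, w) \<notin> arcs s}"
      using finX by (rule finite_subset[rotated]) (auto simp: X_def)
    ultimately have "card {x \<in> X. c < g p x} < M"
      using u(2) card_mono order_le_less_trans by blast
    moreover have "w \<in> {x \<in> X. c < g p x}" using pc(1) w(1) by (simp add: X_def)
    ultimately have "w \<in> U p" unfolding U_def by blast
    then show "w \<in> (\<Union>p\<in>UNIV. U p)" by blast
  qed
  moreover have "finite (\<Union>p\<in>UNIV. U p)"
    using finX by (rule finite_subset[rotated]) (auto simp: U_def)
  ultimately have "card (near (arcs s) M A v) \<le> card (\<Union>p\<in>UNIV. U p)"
    by (rule card_mono[rotated])
  also have "\<dots> \<le> (\<Sum>p\<in>UNIV. card (U p))" by (rule card_UN_le) simp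
  also have "\<dots> \<le> (\<Sum>p\<in>(UNIV :: ('i \<times> bool) set). M)"
    unfolding U_def by (intro sum_mono card_Union_small_superlevel_le finX)
  also have "\<dots> = 2 * CARD('i) * M" by simp
  finally show ?thesis .
qed

text \<open>
  A polynomial Ramsey bound: being to the left in coordinate \<open>i\<close> is a strict order whose chains are
  pairwise disjoint. If these have at most \<open>K\<close> members in every coordinate, the product of the
  chain colourings has \<open>K ^ CARD('i)\<close> classes, each of which is pairwise intersecting and so
  has at most \<open>n\<close> members.
\<close>
lemma ex_disjoint_subset:
  assumes clq: "\<And>S. S \<subseteq> V \<Longrightarrow> (\<forall>x\<in>S. \<forall>y\<in>S. meets x y) \<Longrightarrow> card S \<le> n"
    and X: "X \<subseteq> V" "n * K ^ CARD('i) < card X" and K: "0 < K"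
  shows "\<exists>Y\<subseteq>X. card Y = K \<and> (\<forall>x\<in>Y. \<forall>y\<in>Y. x \<noteq> y \<longrightarrow> \<not> meets x y)"
proof (rule ccontr)
  assume no: "\<not> ?thesis"
  have finX: "finite X" using X(1) finite_V by (rule finite_subset)
  define R where "R i = {(u, v). u \<in> X \<and> v \<in> X \<and> hi i u < lo i v}" for i
  have "colourable (R i) K" for i
  proof (rule colourable_if_chains_le)
    show "finite (R i)"
      by (rule finite_subset[of _ "X \<times> X"]) (auto simp: R_def finX)
    show "trans (R i)"
    proof (rule transI)
      fix x y z assume "(x, y) \<in> R i" "(y, z) \<in> R i"
      moreover from this have "lo i y \<le> hi i y" using X(1) lo_le_hi by (auto simp: R_def)
      ultimately show "(x, z) \<in> R i" by (auto simp: R_def)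
    qed
    show "irrefl (R i)" using X(1) lo_le_hi by (auto simp: irrefl_def R_def not_less)
    show "card S \<le> K" if "finite S" "is_chain (R i) S" for S
    proof (rule ccontr)
      assume S: "\<not> card S \<le> K"
      \<comment> \<open>The chain \<open>S\<close> is larger than \<open>Y\<close>, and an element outside \<open>Y\<close> forces \<open>Y \<subseteq> X\<close>; a chain with
        one element need not lie in \<open>X\<close>.\<close>
      then obtain Y where Y: "Y \<subseteq> S" "card Y = K" using obtain_subset_with_card_n[of K S] by auto
      have "Y \<noteq> S" using S Y by auto
      with Y obtain z where z: "z \<in> S" "z \<notin> Y" by blast
      have "Y \<subseteq> X"
      proof
        fix y assume "y \<in> Y"
        with z Y(1) have "(y, z) \<in> R i \<or> (z, y) \<in> R i"
          by (intro is_chainD[OF that(2)]) auto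
        then show "y \<in> X" by (auto simp: R_def)
      qed
      moreover have "\<forall>x\<in>Y. \<forall>y\<in>Y. x \<noteq> y \<longrightarrow> \<not> meets x y"
      proof (intro ballI impI)
        fix x y assume "x \<in> Y" "y \<in> Y" "x \<noteq> y"
        with Y(1) have "(x, y) \<in> R i \<or> (y, x) \<in> R i"
          by (intro is_chainD[OF that(2)]) auto
        then show "\<not> meets x y" unfolding R_def meets_def by (auto simp: not_le)
      qed
      ultimately show False using no Y(2) by blast
    qed
  qed
  then have "colourable (\<Union>i\<in>UNIV. R i) (K ^ CARD('i))"
    by (intro colourable_UN) simp_all
  then obtain f where f: "\<And>v. f v < K ^ CARD('i)"
    "\<And>u v. (u, v) \<in> (\<Union>i\<in>UNIV. R i) \<Longrightarrow> f u \<noteq> f v"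
    by (rule colourableE) blast
  have cls: "card {x \<in> X. f x = c} \<le> n" for c
  proof (rule clq)
    show "\<forall>x\<in>{x \<in> X. f x = c}. \<forall>y\<in>{x \<in> X. f x = c}. meets x y"
    proof (intro ballI)
      fix x y assume "x \<in> {x \<in> X. f x = c}" "y \<in> {x \<in> X. f x = c}"
      then have "x \<in> X" "y \<in> X" "f x = f y" by auto
      then have "(x, y) \<notin> R i" "(y, x) \<notin> R i" for i
        using f(2)[of x y] f(2)[of y x] by auto
      then show "meets x y" using \<open>x \<in> X\<close> \<open>y \<in> X\<close> by (auto simp: R_def meets_def not_less)
    qed
  qed (use X(1) in auto)
  have "X = (\<Union>c\<in>{..<K ^ CARD('i)}. {x \<in> X. f x = c})" using f(1) by auto
  then have "card X \<le> (\<Sum>c<K ^ CARD('i). card {x \<in> X. f x = c})"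
    using card_UN_le[of "{..<K ^ CARD('i)}" "\<lambda>c. {x \<in> X. f x = c}"] by simp
  also have "\<dots> \<le> (\<Sum>c<K ^ CARD('i). n)" by (intro sum_mono cls)
  also have "\<dots> = n * K ^ CARD('i)" by simp
  finally show False using X(2) by simp
qed

definition induced_tree :: "nat \<Rightarrow> nat \<Rightarrow> (nat list \<Rightarrow> 'a) \<Rightarrow> bool" where
  "induced_tree K k \<phi> \<longleftrightarrow> (\<forall>xs\<in>words K k. \<phi> xs \<in> V) \<and>
    (\<forall>xs\<in>words K k. \<forall>ys\<in>words K k. xs \<noteq> ys \<longrightarrow> \<phi> xs \<noteq> \<phi> ys \<and>
      (meets (\<phi> xs) (\<phi> ys) \<longleftrightarrow> (\<exists>a. ys = xs @ [a]) \<or> (\<exists>a. xs = ys @ [a])))"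

lemma induced_treeD:
  assumes "induced_tree K k \<phi>" "xs \<in> words K k" "ys \<in> words K k" "xs \<noteq> ys"
  shows "\<phi> xs \<noteq> \<phi> ys \<and>
    (meets (\<phi> xs) (\<phi> ys) \<longleftrightarrow> (\<exists>a. ys = xs @ [a]) \<or> (\<exists>a. xs = ys @ [a]))"
  using bspec[OF bspec[OF conjunct2[OF assms(1)[unfolded induced_tree_def]] assms(2)] assms(3)] assms(4)
  by (rule mp)

text \<open>
  The induction hypothesis hangs a tree below each of \<open>K\<close> pairwise disjoint children of \<open>v\<close> that miss
  \<open>u\<close>. Different branches stay disjoint, and the whole tree lies above \<open>v\<close> and misses \<open>u\<close> except at its
  root, which is what makes it fit below the next ancestor.
\<close>
lemma ex_induced_tree:
  assumes clq: "\<And>S. S \<subseteq> V \<Longrightarrow> (\<forall>x\<in>S. \<forall>y\<in>S. meets x y) \<Longrightarrow> card S \<le> n"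
    and K: "0 < K"
    and uv: "(u, v) \<in> level (arcs s) (n * K ^ CARD('i) + 1) k"
  shows "\<exists>\<phi>. \<phi> [] = v \<and> induced_tree K k \<phi> \<and>
    (\<forall>xs\<in>words K k. below s v (\<phi> xs) \<and> (xs \<noteq> [] \<longrightarrow> \<not> meets u (\<phi> xs)))"
  using uv
proof (induction k arbitrary: u v)
  case 0
  then have "v \<in> V" by (auto simp: arcs_def)
  then show ?case by (intro exI[of _ "\<lambda>_. v"]) (auto simp: below_refl words_def induced_tree_def)
next
  case (Suc k)
  let ?E = "arcs s" and ?M = "n * K ^ CARD('i) + 1"
  define S where "S = {w. (v, w) \<in> level ?E ?M k \<and> (u, w) \<notin> ?E}"
  from Suc.prems have uv: "(u, v) \<in> ?E" and "?M \<le> card S" by (auto simp: S_def)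
  have SE: "(v, w) \<in> ?E" if "w \<in> S" for w
    using that level_subset[of ?E ?M k] unfolding S_def by blast
  have "\<exists>Y\<subseteq>S. card Y = K \<and> (\<forall>x\<in>Y. \<forall>y\<in>Y. x \<noteq> y \<longrightarrow> \<not> meets x y)"
  proof (rule ex_disjoint_subset[OF clq])
    show "S \<subseteq> V" using SE by (auto simp: arcs_def)
    show "n * K ^ CARD('i) < card S" using \<open>?M \<le> card S\<close> by simp
  qed (use K in auto)
  then obtain Y where Y: "Y \<subseteq> S" "card Y = K" "\<And>x y. x \<in> Y \<Longrightarrow> y \<in> Y \<Longrightarrow> x \<noteq> y \<Longrightarrow> \<not> meets x y"
    by blast
  have "finite Y" using Y(2) K by (auto intro: card_ge_0_finite)
  then obtain w where bij: "bij_betw w {..<K} Y"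
    using Y(2) ex_bij_betw_nat_finite[of Y] by (auto simp: atLeast0LessThan)
  then have wS: "w i \<in> S" if "i < K" for i using Y(1) that by (auto simp: bij_betw_def)
  have wdisj: "\<not> meets (w i) (w j)" if "i < K" "j < K" "i \<noteq> j" for i j
    using that bij Y(3)[of "w i" "w j"] by (auto simp: bij_betw_def inj_on_def)
  have u_w: "\<not> meets u (w i)" if "i < K" for i
  proof
    assume "meets u (w i)"
    moreover have "(u, w i) \<notin> ?E" "(v, w i) \<in> ?E" using wS[OF that] SE by (auto simp: S_def)
    ultimately show False using uv
      by (auto simp: arcs_def intro: below_trans dest: below_antisym)
  qed
  have "\<exists>\<phi>. i < K \<longrightarrow> \<phi> [] = w i \<and> induced_tree K k \<phi> \<and>
    (\<forall>xs\<in>words K k. below s (w i) (\<phi> xs) \<and> (xs \<noteq> [] \<longrightarrow> \<not> meets v (\<phi> xs)))" for i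
    using Suc.IH[of v "w i"] wS[of i] unfolding S_def by blast
  then obtain \<psi> where \<psi>: "\<And>i. i < K \<Longrightarrow> \<psi> i [] = w i \<and> induced_tree K k (\<psi> i) \<and>
    (\<forall>xs\<in>words K k. below s (w i) (\<psi> i xs) \<and> (xs \<noteq> [] \<longrightarrow> \<not> meets v (\<psi> i xs)))"
    by metis
  have \<psi>0: "\<psi> i [] = w i" if "i < K" for i using \<psi>[OF that] by blast
  have \<psi>1: "\<psi> i xs \<in> V" "below s (w i) (\<psi> i xs)" "xs \<noteq> [] \<Longrightarrow> \<not> meets v (\<psi> i xs)"
    if "i < K" "xs \<in> words K k" for i xs
    using \<psi>[OF that(1)] that(2) unfolding induced_tree_def by blast+
  have \<psi>2: "\<psi> i xs \<noteq> \<psi> i ys \<and>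
      (meets (\<psi> i xs) (\<psi> i ys) \<longleftrightarrow> (\<exists>a. ys = xs @ [a]) \<or> (\<exists>a. xs = ys @ [a]))"
    if "i < K" "xs \<in> words K k" "ys \<in> words K k" "xs \<noteq> ys" for i xs ys
    using \<psi>[OF that(1)] by (intro induced_treeD[OF _ that(2-4)]) simp
  define \<phi> where "\<phi> xs = (case xs of [] \<Rightarrow> v | i # ys \<Rightarrow> \<psi> i ys)" for xs
  have E_v: "v \<in> V" "u \<in> V" "below s u v" using uv by (auto simp: arcs_def)
  have E_w: "below s v (w i)" "meets v (w i)" "v \<noteq> w i" "w i \<in> V" if "i < K" for i
    using SE[OF wS[OF that]] by (auto simp: arcs_def)
  have root: "\<psi> i xs \<noteq> v" "meets v (\<psi> i xs) \<longleftrightarrow> xs = []"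
    if i: "i < K" and xs: "xs \<in> words K k" for i xs
  proof -
    show "meets v (\<psi> i xs) \<longleftrightarrow> xs = []"
      using \<psi>0[OF i] \<psi>1(3)[OF i xs] E_w(2)[OF i] by (cases "xs = []") auto
    then show "\<psi> i xs \<noteq> v"
      using \<psi>0[OF i] E_w(3)[OF i] meets_refl[OF E_v(1)] by (cases "xs = []") auto
  qed
  have branches: "\<not> meets (\<psi> i xs) (\<psi> j ys)"
    if "i < K" "j < K" "i \<noteq> j" "xs \<in> words K k" "ys \<in> words K k" for i j xs ys
    by (rule disjoint_descendants[OF SE[OF wS] SE[OF wS] wdisj]) (use that \<psi>1(2) in auto)
  have Cons_words: "i # xs \<in> words K (Suc k) \<longleftrightarrow> i < K \<and> xs \<in> words K k" for i xs
    by (auto simp: words_def)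
  have \<phi>: "\<phi> [] = v" "\<phi> (i # xs) = \<psi> i xs" for i xs by (simp_all add: \<phi>_def)
  have "\<phi> xs \<in> V" if "xs \<in> words K (Suc k)" for xs
    using that \<psi>1(1) E_v by (cases xs) (auto simp: \<phi> Cons_words)
  moreover have "\<phi> xs \<noteq> \<phi> ys \<and>
      (meets (\<phi> xs) (\<phi> ys) \<longleftrightarrow> (\<exists>a. ys = xs @ [a]) \<or> (\<exists>a. xs = ys @ [a]))"
    if xs: "xs \<in> words K (Suc k)" and ys: "ys \<in> words K (Suc k)" and neq: "xs \<noteq> ys" for xs ys
  proof (cases xs)
    case Nil
    then obtain j zs where "ys = j # zs" using neq by (cases ys) auto
    then show ?thesis using Nil root[of j zs] ys by (auto simp: \<phi> Cons_words)
  next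
    case xsC: (Cons i xs')
    show ?thesis
    proof (cases ys)
      case Nil
      then show ?thesis using xsC root[of i xs'] xs by (auto simp: \<phi> Cons_words meets_sym[of _ v])
    next
      case ysC: (Cons j ys')
      show ?thesis
      proof (cases "i = j")
        case True
        then show ?thesis using \<psi>2[of i xs' ys'] xs ys neq xsC ysC by (auto simp: \<phi> Cons_words)
      next
        case False
        then have "\<not> meets (\<psi> i xs') (\<psi> j ys')"
          using branches xs ys xsC ysC by (auto simp: Cons_words)
        moreover have "meets (\<psi> i xs') (\<psi> i xs')"
          using \<psi>1(1)[of i xs'] xs xsC by (auto intro: meets_refl simp: Cons_words)
        ultimately show ?thesis using False xsC ysC by (auto simp: \<phi>)
      qed
    qed
  qed
  ultimately have "induced_tree K (Suc k) \<phi>" by (simp add: induced_tree_def)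
  moreover have "below s v (\<phi> xs)" if "xs \<in> words K (Suc k)" for xs
    using that \<psi>1(2) E_w(1) by (cases xs) (auto simp: \<phi> Cons_words below_refl intro: below_trans)
  moreover have "\<not> meets u (\<phi> xs)" if in_words: "xs \<in> words K (Suc k)" and "xs \<noteq> []" for xs
  proof -
    obtain i ys where xs: "xs = i # ys" using \<open>xs \<noteq> []\<close> by (cases xs) auto
    then have "i < K" "below s (w i) (\<psi> i ys)" using in_words \<psi>1(2) by (auto simp: Cons_words)
    then have "\<not> meets u (\<psi> i ys)"
      using meets_between[OF E_v(2), of s "w i" "\<psi> i ys"] u_w E_w(1) E_v(3) below_trans by blast
    then show ?thesis by (simp add: \<phi> xs)
  qed
  ultimately show ?case using \<phi>(1) by blast
qed

lemma colourable_meets: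
  assumes clq: "\<And>S. S \<subseteq> V \<Longrightarrow> (\<forall>x\<in>S. \<forall>y\<in>S. meets x y) \<Longrightarrow> card S \<le> n"
    and n: "0 < n"
    and empty: "\<And>s. level (arcs s) M k = {}"
  shows "colourable {(u, v). u \<in> V \<and> v \<in> V \<and> u \<noteq> v \<and> meets u v}
    ((((2 * CARD('i) * M + 1) * n) ^ k) ^ CARD('i \<Rightarrow> bool \<times> bool))"
proof -
  have "colourable (arcs s) (((2 * CARD('i) * M + 1) * n) ^ k)" for s
  proof -
    have "card S \<le> n" if "finite S" "is_chain (arcs s) S" for S
    proof (cases "\<exists>x y. x \<in> S \<and> y \<in> S \<and> x \<noteq> y")
      case True
      have sub: "S \<subseteq> V"
      proof
        fix x assume "x \<in> S"
        then obtain y where "y \<in> S" "x \<noteq> y" using True by metis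
        then show "x \<in> V" using that(2) \<open>x \<in> S\<close> unfolding is_chain_def arcs_def by blast
      qed
      have "meets x y" if "x \<in> S" "y \<in> S" for x y
        using is_chainD[OF \<open>is_chain (arcs s) S\<close> that] meets_refl[of x] sub that meets_sym[of x y]
        by (cases "x = y") (auto simp: arcs_def)
      then show ?thesis using sub by (intro clq) blast+
    next
      case False
      then have "card S \<le> 1" using card_le_Suc0_iff_eq[OF that(1)] by auto
      then show ?thesis using n by simp
    qed
    then have "colourable (arcs s - level (arcs s) M k) (((2 * CARD('i) * M + 1) * n) ^ k)"
      by (intro colourable_diff_level finite_arcs acyclic_arcs card_near_le)
    then show ?thesis by (simp add: empty)
  qed
  then have "colourable (\<Union>s\<in>UNIV. arcs s)
    ((((2 * CARD('i) * M + 1) * n) ^ k) ^ CARD('i \<Rightarrow> bool \<times> bool))"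
    by (intro colourable_UN) simp_all
  then show ?thesis
    by (rule colourable_mono) (use ex_arcs_if_meets in auto)
qed

end

section \<open>Forests\<close>

lemma awalk_if_successively:
  fixes F :: "'v pair_pre_digraph"
  assumes "pair_graph F" "successively (\<lambda>u v. (u, v) \<in> parcs F) (v # vs)" "v \<in> pverts F"
  shows "pre_digraph.awalk (with_proj F) v (zip (v # vs) vs) (last (v # vs))"
    and "pawalk_verts v (zip (v # vs) vs) = v # vs"
proof -
  interpret pair_graph F by (rule assms)
  have "set (zip (v # vs) vs) \<subseteq> parcs F \<and> cas v (zip (v # vs) vs) (last (v # vs)) \<and>
    pawalk_verts v (zip (v # vs) vs) = v # vs"
    using assms(2) by (induction vs arbitrary: v) auto
  then show "awalk v (zip (v # vs) vs) (last (v # vs))" "pawalk_verts v (zip (v # vs) vs) = v # vs"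
    using assms(3) by (auto simp: awalk_def)
qed

text \<open>
  If every vertex of \<open>W\<close> had two neighbours in \<open>W\<close>, the first vertex of a longest path in \<open>W\<close> would
  have a neighbour on the path besides its successor, which closes a cycle of length at least 3.
\<close>
lemma forest_has_leaf:
  fixes F :: "'v pair_pre_digraph"
  assumes F: "undirected_forest F" and W: "W \<subseteq> pverts F" "W \<noteq> {}"
  shows "\<exists>x\<in>W. \<exists>p. \<forall>y\<in>W. (x, y) \<in> parcs F \<longrightarrow> y = p"
proof (rule ccontr)
  assume "\<not> ?thesis"
  then have nb: "\<exists>y\<in>W. (x, y) \<in> parcs F \<and> y \<noteq> p" if "x \<in> W" for x p
    using that by blast
  have pg: "pair_graph F" using F by (simp add: undirected_forest_def)
  interpret pair_graph F by (rule pg)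
  have sym: "(y, x) \<in> parcs F" if "(x, y) \<in> parcs F" for x y
    using that arcs_symmetric by blast
  define P where "P xs \<longleftrightarrow> xs \<noteq> [] \<and> set xs \<subseteq> W \<and> distinct xs \<and>
    successively (\<lambda>u v. (u, v) \<in> parcs F) xs" for xs
  have finW: "finite W" using W(1) pair_finite_verts by (rule finite_subset)
  obtain w where "w \<in> W" using W(2) by blast
  then have "P [w]" by (simp add: P_def)
  moreover have "length xs < card W + 1" if "P xs" for xs
    using that card_mono[OF finW, of "set xs"] distinct_card[of xs] by (auto simp: P_def)
  ultimately obtain xs where xs: "P xs" and longest: "\<And>ys. P ys \<Longrightarrow> length ys \<le> length xs"
    using ex_has_greatest_nat[of P "[w]" length "card W + 1"] by blast
  obtain x xs' where x: "xs = x # xs'" using xs by (cases xs) (auto simp: P_def)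
  obtain y where y: "y \<in> W" "(x, y) \<in> parcs F" "xs' \<noteq> [] \<Longrightarrow> y \<noteq> hd xs'"
    using nb[of x "hd xs'"] xs x by (auto simp: P_def)
  have "y \<in> set xs"
  proof (rule ccontr)
    assume "y \<notin> set xs"
    then have "P (y # xs)" using xs x y(1) sym[OF y(2)] by (auto simp: P_def)
    then show False using longest[of "y # xs"] by simp
  qed
  moreover have "y \<noteq> x" using y(2) pair_no_loops[of "(x, y)"] by auto
  ultimately have "y \<in> set xs'" using x by simp
  then obtain z zs where z: "xs' = z # zs" "y \<in> set zs" using y(3) by (cases xs') auto
  then obtain as bs where zs: "zs = as @ y # bs" by (auto simp: in_set_conv_decomp)
  define vs where "vs = x # z # as @ [y]"
  have walk: "successively (\<lambda>u v. (u, v) \<in> parcs F) (y # vs)"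
    using xs sym[OF y(2)] unfolding P_def vs_def x z(1) zs
    by (auto simp: successively_append_iff successively_Cons hd_append split: if_splits)
  have "y \<in> pverts F" using y(1) W(1) by blast
  note aw = awalk_if_successively[OF pg walk this]
  have "distinct (tl (pawalk_verts y (zip (y # vs) vs)))"
    using xs unfolding aw(2) unfolding P_def x z(1) zs vs_def by auto
  moreover have "last (y # vs) = y" "zip (y # vs) vs \<noteq> []" by (simp_all add: vs_def)
  ultimately have "cycle (zip (y # vs) vs)" using aw(1) unfolding cycle_def by metis
  moreover have "3 \<le> length (zip (y # vs) vs)" by (simp add: vs_def)
  ultimately show False using F by (auto simp: undirected_forest_def)
qed

text \<open>
  Vertices are attached leaf by leaf. Each list ends with the label of its own vertex, which makes
  the embedding injective, and uses only labels of vertices present so far, so no old list extends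
  the new one. A vertex that starts a new component gets its own label twice: its parent in the tree
  has length 1 and is therefore never used, as all lists have length at least 2.
\<close>
lemma forest_embeds_in_list_tree:
  fixes F :: "'v pair_pre_digraph" and lab :: "'v \<Rightarrow> 'b"
  assumes F: "undirected_forest F" and inj: "inj_on lab (pverts F)" and W: "W \<subseteq> pverts F"
  shows "\<exists>\<phi>. (\<forall>x\<in>W. 2 \<le> length (\<phi> x) \<and> length (\<phi> x) \<le> card W + 1 \<and>
      set (\<phi> x) \<subseteq> lab ` W \<and> last (\<phi> x) = lab x) \<and>
    (\<forall>x\<in>W. \<forall>y\<in>W. (x, y) \<in> parcs F \<longleftrightarrow> (\<exists>a. \<phi> y = \<phi> x @ [a]) \<or> (\<exists>a. \<phi> x = \<phi> y @ [a]))"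
proof -
  have pg: "pair_graph F" using F by (simp add: undirected_forest_def)
  interpret pair_graph F by (rule pg)
  have "finite W" using W pair_finite_verts by (rule finite_subset)
  then show ?thesis using W
  proof (induction W rule: finite_psubset_induct)
    case (psubset W)
    show ?case
    proof (cases "W = {}")
      case False
      then obtain x p where x: "x \<in> W" and leaf: "\<And>y. y \<in> W \<Longrightarrow> (x, y) \<in> parcs F \<Longrightarrow> y = p"
        using forest_has_leaf[OF F psubset.prems] by metis
      define W' where "W' = W - {x}"
      have W': "W' \<subset> W" "W' \<subseteq> pverts F" using x psubset.prems by (auto simp: W'_def)
      obtain \<psi> where \<psi>: "\<And>y. y \<in> W' \<Longrightarrow> 2 \<le> length (\<psi> y) \<and> length (\<psi> y) \<le> card W' + 1 \<and>
          set (\<psi> y) \<subseteq> lab ` W' \<and> last (\<psi> y) = lab y"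
        and \<psi>adj: "\<And>y z. y \<in> W' \<Longrightarrow> z \<in> W' \<Longrightarrow>
          (y, z) \<in> parcs F \<longleftrightarrow> (\<exists>a. \<psi> z = \<psi> y @ [a]) \<or> (\<exists>a. \<psi> y = \<psi> z @ [a])"
        using psubset.IH[OF W'] by blast
      have card: "card W = card W' + 1"
        using x psubset.hyps card_Suc_Diff1[of W x] by (simp add: W'_def)
      have new: "lab x \<notin> lab ` W'"
        using inj psubset.prems x unfolding W'_def inj_on_def by blast
      define l where "l = (if p \<in> W' \<and> (x, p) \<in> parcs F then \<psi> p @ [lab x] else [lab x, lab x])"
      define \<phi> where "\<phi> = \<psi>(x := l)"
      have \<phi>x: "\<phi> x = l" and \<phi>W': "\<And>y. y \<in> W' \<Longrightarrow> \<phi> y = \<psi> y" by (auto simp: \<phi>_def W'_def)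
      have l: "2 \<le> length l" "length l \<le> card W + 1" "set l \<subseteq> lab ` W" "last l = lab x"
        using \<psi>[of p] card x W'(1) by (auto simp: l_def)
      have "lab x \<in> set l" using l(1,4) by (metis last_in_set list.size(3) not_numeral_le_zero)
      then have no: "\<psi> y \<noteq> l @ [a]" if "y \<in> W'" for y a
        using \<psi>[OF that] new by auto
      have inj\<psi>: "\<psi> y = \<psi> p \<longleftrightarrow> y = p" if "y \<in> W'" "p \<in> W'" for y
        using \<psi>[OF that(1)] \<psi>[OF that(2)] inj that W'(2)
        by (metis inj_onD subsetD)
      have xadj: "(x, y) \<in> parcs F \<longleftrightarrow> (\<exists>a. l = \<psi> y @ [a])" if y: "y \<in> W'" for y
      proof -
        have "(x, y) \<in> parcs F \<longleftrightarrow> y = p \<and> (x, p) \<in> parcs F"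
          using leaf[of y] y W'(1) by auto
        moreover have "\<psi> y \<noteq> [lab x]" using \<psi>[OF y] by auto
        ultimately show ?thesis
          using inj\<psi>[OF y] y by (auto simp: l_def Cons_eq_append_conv)
      qed
      have sym: "(y, x) \<in> parcs F \<longleftrightarrow> (x, y) \<in> parcs F" for y using arcs_symmetric by blast
      have irr: "(x, x) \<notin> parcs F" using pair_no_loops[of "(x, x)"] by auto
      have split: "y = x \<or> y \<in> W'" if "y \<in> W" for y using that by (auto simp: W'_def)
      have "2 \<le> length (\<phi> y) \<and> length (\<phi> y) \<le> card W + 1 \<and> set (\<phi> y) \<subseteq> lab ` W \<and> last (\<phi> y) = lab y"
        if "y \<in> W" for y
        using split[OF that]
      proof
        assume "y \<in> W'"
        moreover have "lab ` W' \<subseteq> lab ` W" using W'(1) by blast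
        ultimately show ?thesis using \<psi>[of y] \<phi>W'[of y] card by auto
      qed (use l \<phi>x in auto)
      moreover have "(y, z) \<in> parcs F \<longleftrightarrow> (\<exists>a. \<phi> z = \<phi> y @ [a]) \<or> (\<exists>a. \<phi> y = \<phi> z @ [a])"
        if "y \<in> W" "z \<in> W" for y z
        using split[OF that(1)]
      proof
        assume y: "y = x"
        from split[OF that(2)] show ?thesis
        proof
          assume "z = x"
          then show ?thesis using y irr by simp
        next
          assume "z \<in> W'"
          then show ?thesis using xadj no unfolding y \<phi>x \<phi>W'[OF \<open>z \<in> W'\<close>] by blast
        qed
      next
        assume y: "y \<in> W'"
        from split[OF that(2)] show ?thesis
        proof
          assume z: "z = x"
          then show ?thesis using xadj[OF y] no[OF y] unfolding z \<phi>x \<phi>W'[OF y] sym[of y] by blast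
        next
          assume "z \<in> W'"
          then show ?thesis using \<psi>adj[OF y] unfolding \<phi>W'[OF y] \<phi>W'[OF \<open>z \<in> W'\<close>] by blast
        qed
      qed
      ultimately show ?thesis by blast
    qed simp
  qed
qed

section \<open>Boxes in Euclidean space\<close>

lemma box_corners:
  fixes \<B> :: "(real ^ 'd) set set"
  assumes "finite \<B>" "\<And>B. B \<in> \<B> \<Longrightarrow> axis_aligned_box B"
  obtains lo hi :: "'d \<Rightarrow> (real ^ 'd) set \<Rightarrow> real"
  where "box_family \<B> lo hi"
    and "\<And>A B. A \<in> \<B> \<Longrightarrow> B \<in> \<B> \<Longrightarrow> box_family.meets lo hi A B \<longleftrightarrow> A \<inter> B \<noteq> {}"
proof -
  have "\<exists>a b :: real ^ 'd. B \<in> \<B> \<longrightarrow> (\<forall>i. a $ i < b $ i) \<and> B = cbox a b" for B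
    using assms(2)[of B] unfolding axis_aligned_box_def by blast
  then obtain a b :: "(real ^ 'd) set \<Rightarrow> real ^ 'd" where
    ab: "\<And>B i. B \<in> \<B> \<Longrightarrow> a B $ i < b B $ i" "\<And>B. B \<in> \<B> \<Longrightarrow> B = cbox (a B) (b B)"
    by metis
  have fam: "box_family \<B> (\<lambda>i B. a B $ i) (\<lambda>i B. b B $ i)"
  proof
    show "A = B" if AB: "A \<in> \<B>" "B \<in> \<B>" and eq: "\<And>i. a A $ i = a B $ i" "\<And>i. b A $ i = b B $ i"
      for A B
    proof -
      have "a A = a B" "b A = b B" using eq by (simp_all add: vec_eq_iff)
      then show ?thesis using ab(2)[OF AB(1)] ab(2)[OF AB(2)] by simp
    qed
  qed (use assms(1) ab(1) in \<open>auto intro: less_imp_le\<close>)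
  interpret box_family \<B> "\<lambda>i B. a B $ i" "\<lambda>i B. b B $ i" by (rule fam)
  have "meets A B \<longleftrightarrow> A \<inter> B \<noteq> {}" if AB: "A \<in> \<B>" "B \<in> \<B>" for A B
  proof
    assume m: "meets A B"
    have "(\<chi> i. max (a A $ i) (a B $ i)) \<in> cbox (a A) (b A) \<inter> cbox (a B) (b B)"
      using m ab(1)[OF AB(1)] ab(1)[OF AB(2)]
      by (auto simp: mem_box_cart meets_def less_imp_le)
    then show "A \<inter> B \<noteq> {}" using ab(2)[OF AB(1)] ab(2)[OF AB(2)] by blast
  next
    assume "A \<inter> B \<noteq> {}"
    then obtain x where "x \<in> cbox (a A) (b A)" "x \<in> cbox (a B) (b B)"
      using ab(2)[OF AB(1)] ab(2)[OF AB(2)] by blast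
    then show "meets A B" unfolding meets_def mem_box_cart by (meson order_trans)
  qed
  with fam show ?thesis by (rule that)
qed

lemma chromatic_number_le_if_colourable:
  assumes "colourable (parcs G) k"
  shows "chromatic_number G \<le> k"
proof -
  obtain f where "\<And>v. f v < k" "\<And>u v. (u, v) \<in> parcs G \<Longrightarrow> f u \<noteq> f v"
    using assms by (rule colourableE) blast
  then have "proper_coloring G k f" unfolding proper_coloring_def by auto
  then show ?thesis unfolding chromatic_number_def by (intro Least_le) blast
qed

lemma contains_induced_if_words_embed:
  fixes F :: "'v pair_pre_digraph" and \<phi> :: "nat list \<Rightarrow> 'w"
  assumes F: "undirected_forest F" and G: "pair_graph G" and K: "card (pverts F) + 1 \<le> K"
    and verts: "\<And>xs. xs \<in> words K K \<Longrightarrow> \<phi> xs \<in> pverts G"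
    and arcs: "\<And>xs ys. xs \<in> words K K \<Longrightarrow> ys \<in> words K K \<Longrightarrow> xs \<noteq> ys \<Longrightarrow> \<phi> xs \<noteq> \<phi> ys \<and>
      ((\<phi> xs, \<phi> ys) \<in> parcs G \<longleftrightarrow> (\<exists>a. ys = xs @ [a]) \<or> (\<exists>a. xs = ys @ [a]))"
  shows "contains_induced G F"
proof -
  have pg: "pair_graph F" using F by (simp add: undirected_forest_def)
  interpret F: pair_graph F by (rule pg)
  interpret G: pair_graph G by (rule G)
  obtain lab where lab: "bij_betw lab (pverts F) {0..<card (pverts F)}"
    using ex_bij_betw_finite_nat[OF F.pair_finite_verts] by blast
  obtain \<psi> where \<psi>: "\<And>x. x \<in> pverts F \<Longrightarrow> length (\<psi> x) \<le> card (pverts F) + 1 \<and>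
      set (\<psi> x) \<subseteq> lab ` pverts F \<and> last (\<psi> x) = lab x"
    and adj: "\<And>x y. x \<in> pverts F \<Longrightarrow> y \<in> pverts F \<Longrightarrow>
      (x, y) \<in> parcs F \<longleftrightarrow> (\<exists>a. \<psi> y = \<psi> x @ [a]) \<or> (\<exists>a. \<psi> x = \<psi> y @ [a])"
    using forest_embeds_in_list_tree[OF F bij_betw_imp_inj_on[OF lab] subset_refl] by blast
  have set\<psi>: "\<psi> x \<in> words K K" if "x \<in> pverts F" for x
    using \<psi>[OF that] bij_betw_imp_surj_on[OF lab] K by (auto simp: words_def)
  have inj\<psi>: "\<psi> x \<noteq> \<psi> y" if "x \<in> pverts F" "y \<in> pverts F" "x \<noteq> y" for x y
    using \<psi>[OF that(1)] \<psi>[OF that(2)] bij_betw_imp_inj_on[OF lab] that by (metis inj_onD)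
  show ?thesis unfolding contains_induced_iff[OF G pg]
  proof (intro exI[of _ "\<phi> \<circ> \<psi>"] conjI ballI)
    show "inj_on (\<phi> \<circ> \<psi>) (pverts F)"
    proof (rule inj_onI, rule ccontr)
      fix x y assume "x \<in> pverts F" "y \<in> pverts F" "(\<phi> \<circ> \<psi>) x = (\<phi> \<circ> \<psi>) y" "x \<noteq> y"
      then show False using arcs[OF set\<psi> set\<psi> inj\<psi>] by auto
    qed
    show "(\<phi> \<circ> \<psi>) ` pverts F \<subseteq> pverts G" using verts set\<psi> by auto
    fix x y assume xy: "x \<in> pverts F" "y \<in> pverts F"
    show "(x, y) \<in> parcs F \<longleftrightarrow> ((\<phi> \<circ> \<psi>) x, (\<phi> \<circ> \<psi>) y) \<in> parcs G"
    proof (cases "x = y")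
      case True
      then show ?thesis using F.pair_no_loops[of "(x, x)"] G.pair_no_loops[of "(\<phi> (\<psi> x), \<phi> (\<psi> x))"] by auto
    next
      case False
      then show ?thesis using adj[OF xy] arcs[OF set\<psi>[OF xy(1)] set\<psi>[OF xy(2)] inj\<psi>[OF xy]] by simp
    qed
  qed
qed

theorem theorem1:
  fixes F :: "'v pair_pre_digraph"
  assumes "undirected_forest F"
  shows "polynomially_chi_bounded
    {G :: (real ^ 'd) set pair_pre_digraph. box_intersection_graph G \<and> \<not> contains_induced G F}"
proof -
  \<comment> \<open>\<open>K\<close> serves as branching and as depth of the tree: an embedded forest uses \<open>card (pverts F)\<close>
    labels and lists of length at most \<open>card (pverts F) + 1\<close>.\<close>
  define K where "K = card (pverts F) + 1"
  define D where "D = K ^ CARD('d)"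
  define N where "N = CARD('d \<Rightarrow> bool \<times> bool)"
  \<comment> \<open>The clique bound is \<open>n + 1\<close> instead of \<open>n\<close> so that it is positive for the empty family.\<close>
  define M where "M n = (n + 1) * D + 1" for n
  define f where "f n = (((2 * CARD('d) * M n + 1) * (n + 1)) ^ K) ^ N" for n
  have "polynomial_function f"
    unfolding polynomial_function_def
  proof (intro exI allI)
    fix n
    let ?p = "([:2 * real CARD('d):] * ([:1, 1:] * [:real D:] + 1) + 1) * [:1, 1:]"
    have "real ((2 * CARD('d) * M n + 1) * (n + 1)) = poly ?p (real n)"
      by (simp add: M_def algebra_simps)
    then show "real (f n) = poly ((?p ^ K) ^ N) (real n)"
      unfolding f_def of_nat_power poly_power by (simp only:)
  qed
  moreover have "chromatic_number G \<le> f (clique_number G)"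
    if G: "box_intersection_graph G" and free: "\<not> contains_induced G F"
    for G :: "(real ^ 'd) set pair_pre_digraph"
  proof -
    obtain \<B> where \<B>: "finite \<B>" "\<And>B. B \<in> \<B> \<Longrightarrow> axis_aligned_box B" and GB: "G = intersection_graph \<B>"
      using G unfolding box_intersection_graph_def by blast
    obtain lo hi :: "'d \<Rightarrow> (real ^ 'd) set \<Rightarrow> real" where fam: "box_family \<B> lo hi"
      and m: "\<And>A B. A \<in> \<B> \<Longrightarrow> B \<in> \<B> \<Longrightarrow> box_family.meets lo hi A B \<longleftrightarrow> A \<inter> B \<noteq> {}"
      using box_corners[OF \<B>] by blast
    interpret box_family \<B> lo hi by (rule fam)
    have parcs: "parcs G = {(u, v). u \<in> \<B> \<and> v \<in> \<B> \<and> u \<noteq> v \<and> meets u v}"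
      using m unfolding GB intersection_graph_def by auto
    have pverts: "pverts G = \<B>" by (simp add: GB intersection_graph_def)
    have clq: "card S \<le> clique_number G + 1" if "S \<subseteq> \<B>" "\<forall>x\<in>S. \<forall>y\<in>S. meets x y" for S
    proof -
      have "clique G S" using that by (auto simp: clique_def parcs pverts)
      then show ?thesis
        using clique_number_attained(2)[of G S] \<B>(1) pverts by simp
    qed
    have "level (arcs s) (M (clique_number G)) K = {}" for s
    proof (rule equals0I)
      fix e assume "e \<in> level (arcs s) (M (clique_number G)) K"
      then obtain u v where "(u, v) \<in> level (arcs s) ((clique_number G + 1) * K ^ CARD('d) + 1) K"
        by (cases e) (auto simp: M_def D_def)
      then obtain \<phi> where \<phi>: "induced_tree K K \<phi>"
        using ex_induced_tree[OF clq, of K u v s K] unfolding K_def by auto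
      have "contains_induced G F"
      proof (rule contains_induced_if_words_embed[OF assms])
        show "pair_graph G" unfolding GB by (rule pair_graph_intersection_graph[OF \<B>(1)])
        show "card (pverts F) + 1 \<le> K" by (simp add: K_def)
        show "\<phi> xs \<in> pverts G" if "xs \<in> words K K" for xs
          using that \<phi> by (simp add: induced_tree_def pverts)
        show "\<phi> xs \<noteq> \<phi> ys \<and>
            ((\<phi> xs, \<phi> ys) \<in> parcs G \<longleftrightarrow> (\<exists>a. ys = xs @ [a]) \<or> (\<exists>a. xs = ys @ [a]))"
          if "xs \<in> words K K" "ys \<in> words K K" "xs \<noteq> ys" for xs ys
          using induced_treeD[OF \<phi> that] \<phi> that by (simp add: induced_tree_def parcs)
      qed
      with free show False by simp
    qed
    then have "colourable (parcs G) (f (clique_number G))"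
      unfolding parcs f_def N_def by (intro colourable_meets clq) auto
    then show ?thesis by (rule chromatic_number_le_if_colourable)
  qed
  ultimately show ?thesis unfolding polynomially_chi_bounded_def by blast
qed

end
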